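(* Let $a_j,b_j\in\mathbb{N}_0$ and integers $c_j\ge3$ for all $j\ge1$. (i) If $r\ge1$ and $\mathbf{s}=(\{2\}^{b_1},c_1,\{2\}^{a_1},1,\dots,\{2\}^{b_r},c_r,\{2\}^{a_r},1)$, then \[\zeta^\star(\mathbf{s})=\sum_{\mathbf{p}\in\Pi(\overline{2b_1+2},\{1\}^{c_1-3},\overline{2a_1+2},\,\dots,\,\overline{2b_r+2},\{1\}^{c_r-3},\overline{2a_r+2})}2^{\ell(\mathbf{p})}\zeta(\mathbf{p}).\] (ii) If $r\ge0$, $a_0\in\mathbb{N}$ and $\mathbf{s}=(\{2\}^{a_0},1,\{2\}^{b_1},c_1,\{2\}^{a_1},1,\dots,\{2\}^{b_r},c_r,\{2\}^{a_r},1)$, then \[\zeta^\star(\mathbf{s})=\sum_{\mathbf{p}\in\Pi(2a_0+1,\overline{2b_1+2},\{1\}^{c_1-3},\overline{2a_1+2},\,\dots,\,\overline{2b_r+2},\{1\}^{c_r-3},\overline{2a_r+2})}2^{\ell(\mathbf{p})}\zeta(\mathbf{p}).\]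
   Context: $\mathbb{N}=\{1,2,\dots\}$, $\mathbb{N}_0=\mathbb{N}\cup\{0\}$; for a positive integer $m$, $\overline{m}$ denotes $-m$. $\{x\}^a$ denotes $a$ consecutive copies of $x$. For $\mathbf{s}=(s_1,\dots,s_\ell)$ with nonzero integer entries, $H_n(\mathbf{s})=\sum_{n\ge k_1>\cdots>k_\ell\ge1}\prod_{i=1}^\ell \frac{\operatorname{sgn}(s_i)^{k_i}}{k_i^{|s_i|}}$, $H^\star_n(\mathbf{s})$ is the same sum with $\ge$ in place of $>$, and when $s_1\ne1$, $\zeta(\mathbf{s})=\lim_{n\to\infty}H_n(\mathbf{s})$, $\zeta^\star(\mathbf{s})=\lim_{n\to\infty}H^\star_n(\mathbf{s})$. For nonzero integers $a,b$, $a\oplus b=\operatorname{sgn}(a)b+\operatorname{sgn}(b)a$. For a sequence $(s_1,\dots,s_m)$ of nonzero integers, $\Pi(s_1,\dots,s_m)$ is the set of the $2^{m-1}$ indices $s_1\circ\cdots\circ s_m$ where each $\circ$ is independently "," or $\oplus$ (entries joined by $\oplus$ merge into one component); $\ell(\mathbf{p})$ is the number of components. *)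

theory Defs
  imports "HOL-Analysis.Analysis"
begin

text \<open>
  An index \<open>(s\<^sub>1, \<dots>, s\<^sub>l)\<close> is a list of nonzero integers; a barred entry is a negative one.
  The summation variables \<open>n \<ge> k\<^sub>1 > \<dots> > k\<^sub>l \<ge> 1\<close> (resp. with \<open>\<ge>\<close>) form a list of the same length.
\<close>

definition harmonic_term :: "int list \<Rightarrow> nat list \<Rightarrow> real" where
  "harmonic_term s ks =
     (\<Prod>i<length s. real_of_int (sgn (s ! i)) ^ (ks ! i) / real (ks ! i) ^ nat \<bar>s ! i\<bar>)"

definition mhs :: "nat \<Rightarrow> int list \<Rightarrow> real" where
  "mhs n s =
     (\<Sum>ks | length ks = length s \<and> set ks \<subseteq> {1..n} \<and> sorted_wrt (>) ks. harmonic_term s ks)"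

definition mhs_star :: "nat \<Rightarrow> int list \<Rightarrow> real" where
  "mhs_star n s =
     (\<Sum>ks | length ks = length s \<and> set ks \<subseteq> {1..n} \<and> sorted_wrt (\<ge>) ks. harmonic_term s ks)"

text \<open>The next two are meaningful only if the first entry of the index is not \<open>1\<close>.\<close>

definition mzv :: "int list \<Rightarrow> real" where
  "mzv s = lim (\<lambda>n. mhs n s)"

definition mzv_star :: "int list \<Rightarrow> real" where
  "mzv_star s = lim (\<lambda>n. mhs_star n s)"

definition oplus :: "int \<Rightarrow> int \<Rightarrow> int" where
  "oplus a b = sgn a * b + sgn b * a"

text \<open>
  At the first separator one either keeps the comma or merges the two entries it separates.
  The value at the empty list is irrelevant.
\<close>

fun index_merges :: "int list \<Rightarrow> int list set" where
  "index_merges [] = {[]}"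
| "index_merges [x] = {[x]}"
| "index_merges (x # y # xs) =
     (#) x ` index_merges (y # xs) \<union> index_merges (oplus x y # xs)"

text \<open>
  Distinct choices of separators give distinct indices, so summing over the set
  \<open>index_merges s\<close> is the same as summing over the choices.
\<close>

lemma oplus_nonzero_abs:
  assumes "x \<noteq> 0" "y \<noteq> 0"
  shows "\<bar>oplus x y\<bar> = \<bar>x\<bar> + \<bar>y\<bar>" "oplus x y \<noteq> 0"
  using assms by (auto simp: oplus_def sgn_if)

lemma index_merges_hd:
  assumes "p \<in> index_merges (x # xs)" "0 \<notin> set (x # xs)"
  shows "p \<noteq> [] \<and> \<bar>x\<bar> \<le> \<bar>hd p\<bar>"
  using assms
proof (induction xs arbitrary: x p)
  case (Cons y xs)
  show ?case
  proof (cases "p \<in> index_merges (oplus x y # xs)")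
    case True
    then show ?thesis
      using Cons.IH[of p "oplus x y"] Cons.prems(2) oplus_nonzero_abs[of x y] by fastforce
  qed (use Cons.prems in auto)
qed simp

lemma finite_card_index_merges:
  assumes "0 \<notin> set (x # xs)"
  shows "finite (index_merges (x # xs)) \<and> card (index_merges (x # xs)) = 2 ^ length xs"
  using assms
proof (induction xs arbitrary: x)
  case (Cons y xs)
  have nz: "x \<noteq> 0" "y \<noteq> 0" "0 \<notin> set xs"
    using Cons.prems by auto
  note o = oplus_nonzero_abs[OF nz(1,2)]
  have 1: "finite (index_merges (y # xs)) \<and> card (index_merges (y # xs)) = 2 ^ length xs"
    using Cons.IH[of y] nz by auto
  have 2: "finite (index_merges (oplus x y # xs)) \<and>
      card (index_merges (oplus x y # xs)) = 2 ^ length xs"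
    using Cons.IH[of "oplus x y"] nz o by auto
  have "(#) x ` index_merges (y # xs) \<inter> index_merges (oplus x y # xs) = {}"
    using index_merges_hd[of _ "oplus x y" xs] nz o by fastforce
  then show ?case
    using 1 2 by (simp add: card_Un_disjoint card_image)
qed simp

definition star_index :: "(nat \<Rightarrow> nat) \<Rightarrow> (nat \<Rightarrow> nat) \<Rightarrow> (nat \<Rightarrow> nat) \<Rightarrow> nat \<Rightarrow> int list" where
  "star_index a b c r =
     concat (map (\<lambda>j. replicate (b j) 2 @ [int (c j)] @ replicate (a j) 2 @ [1]) [1..<r + 1])"

definition merge_index :: "(nat \<Rightarrow> nat) \<Rightarrow> (nat \<Rightarrow> nat) \<Rightarrow> (nat \<Rightarrow> nat) \<Rightarrow> nat \<Rightarrow> int list" where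
  "merge_index a b c r =
     concat (map (\<lambda>j. [- int (2 * b j + 2)] @ replicate (c j - 3) 1 @ [- int (2 * a j + 2)])
       [1..<r + 1])"

end

theory Submission
  imports Defs "HOL-Real_Asymp.Real_Asymp"
begin

text \<open>
  The identities are limits of finite ones. With \<open>w\<^sub>n(k) = (n choose k) / (n + k choose k)\<close>,
  the star sum with upper bound \<open>n\<close> equals \<open>\<Sum>k\<le>n. w\<^sub>n(k) f(k)\<close>, where \<open>f(k)\<close> collects
  the terms of the right-hand side with largest summation index \<open>k\<close>. This is shown by prepending
  entries to the star index: since \<open>w\<^sub>n(k) - w\<^sub>n\<^sub>-\<^sub>1(k) = (k/n)\<^sup>2 w\<^sub>n(k)\<close>, an entry 2 divides \<open>f\<close>
  by \<open>k\<^sup>2\<close>, and the telescoping tails of \<open>k w\<^sub>n(k)\<close> and \<open>(-1)\<^sup>k w\<^sub>n(k)\<close> give the effect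
  of an entry 1 and of an entry \<open>c \<ge> 3\<close>. As \<open>0 \<le> w\<^sub>n(k) \<le> 1\<close> and \<open>w\<^sub>n(k)\<close> tends to 1,
  dominated convergence finishes the proof.
\<close>

section \<open>Recursion of harmonic sums on the leading entry\<close>

definition entry_weight :: "int \<Rightarrow> nat \<Rightarrow> real" where
  "entry_weight x k = real_of_int (sgn x) ^ k / real k ^ nat \<bar>x\<bar>"

lemma harmonic_term_Cons:
  "harmonic_term (x # s) (k # ks) = entry_weight x k * harmonic_term s ks"
  by (simp add: harmonic_term_def entry_weight_def prod.lessThan_Suc_shift del: prod.lessThan_Suc)

lemma finite_bounded_lists:
  "finite {ks. length ks = l \<and> set ks \<subseteq> {1..n::nat} \<and> P ks}"
  by (rule finite_subset[OF _ finite_lists_length_eq[of "{1..n}" l]]) auto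

lemma mhs_Nil [simp]: "mhs n [] = 1"
proof -
  have "{ks. length ks = length ([]::int list) \<and> set ks \<subseteq> {1..n} \<and> sorted_wrt (>) ks} = {[]}"
    by auto
  then show ?thesis by (simp add: mhs_def harmonic_term_def)
qed

lemma mhs_star_Nil [simp]: "mhs_star n [] = 1"
proof -
  have "{ks. length ks = length ([]::int list) \<and> set ks \<subseteq> {1..n} \<and> sorted_wrt (\<ge>) ks} = {[]}"
    by auto
  then show ?thesis by (simp add: mhs_star_def harmonic_term_def)
qed

text \<open>Splits off the largest summation variable for strict and weak sums at once:
  \<open>m k\<close>, later \<open>k - 1\<close> or \<open>k\<close>, is the bound that the head
  \<open>k\<close> imposes on the remaining variables.\<close>

lemma sum_lists_Cons:
  fixes h :: "nat \<Rightarrow> nat list \<Rightarrow> real"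
  assumes "\<And>k ks. k \<in> {1..n} \<Longrightarrow> set ks \<subseteq> {1..n} \<and> (\<forall>j\<in>set ks. R k j) \<longleftrightarrow> set ks \<subseteq> {1..m k}"
  shows "(\<Sum>ks | length ks = Suc l \<and> set ks \<subseteq> {1..n} \<and> sorted_wrt R ks. h (hd ks) (tl ks)) =
    (\<Sum>k=1..n. \<Sum>ks | length ks = l \<and> set ks \<subseteq> {1..m k} \<and> sorted_wrt R ks. h k ks)"
proof -
  let ?A = "\<lambda>k. {ks. length ks = l \<and> set ks \<subseteq> {1..m k} \<and> sorted_wrt R ks}"
  have "(\<Sum>k=1..n. \<Sum>ks\<in>?A k. h k ks) = (\<Sum>(k, ks)\<in>Sigma {1..n} ?A. h k ks)"
    by (rule sum.Sigma) (auto intro: finite_bounded_lists simp del: One_nat_def)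
  also have "\<dots> = (\<Sum>ks | length ks = Suc l \<and> set ks \<subseteq> {1..n} \<and> sorted_wrt R ks. h (hd ks) (tl ks))"
  proof (rule sum.reindex_bij_witness[where i = "\<lambda>ks. (hd ks, tl ks)" and j = "\<lambda>(k, ks). k # ks"])
    fix a assume "a \<in> Sigma {1..n} ?A"
    then obtain k ks where a: "a = (k, ks)" "k \<in> {1..n}" "ks \<in> ?A k" by auto
    with assms[of k ks] show "(case a of (k, ks) \<Rightarrow> k # ks) \<in>
        {ks. length ks = Suc l \<and> set ks \<subseteq> {1..n} \<and> sorted_wrt R ks}"
      by auto
  next
    fix b assume "b \<in> {ks. length ks = Suc l \<and> set ks \<subseteq> {1..n} \<and> sorted_wrt R ks}"
    then obtain k ks where b: "b = k # ks" "k \<in> {1..n}" "length ks = l" "set ks \<subseteq> {1..n}"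
        "sorted_wrt R ks" "\<forall>j\<in>set ks. R k j"
      by (cases b) auto
    with assms[of k ks] show "(hd b, tl b) \<in> Sigma {1..n} ?A" by auto
    from b show "(case (hd b, tl b) of (k, ks) \<Rightarrow> k # ks) = b" by simp
  qed auto
  finally show ?thesis ..
qed

lemma mhs_Cons: "mhs n (x # s) = (\<Sum>k=1..n. entry_weight x k * mhs (k - 1) s)"
proof -
  have "mhs n (x # s) = (\<Sum>ks | length ks = Suc (length s) \<and> set ks \<subseteq> {1..n} \<and> sorted_wrt (>) ks.
      entry_weight x (hd ks) * harmonic_term s (tl ks))"
    unfolding mhs_def
    by (rule sum.cong) (auto simp: length_Suc_conv harmonic_term_Cons)
  also have "\<dots> = (\<Sum>k=1..n. \<Sum>ks | length ks = length s \<and> set ks \<subseteq> {1..k - 1} \<and> sorted_wrt (>) ks.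
      entry_weight x k * harmonic_term s ks)"
    by (rule sum_lists_Cons) (fastforce simp: subset_iff)
  finally show ?thesis by (simp add: mhs_def sum_distrib_left)
qed

lemma mhs_star_Cons: "mhs_star n (x # s) = (\<Sum>k=1..n. entry_weight x k * mhs_star k s)"
proof -
  have "mhs_star n (x # s) = (\<Sum>ks | length ks = Suc (length s) \<and> set ks \<subseteq> {1..n} \<and> sorted_wrt (\<ge>) ks.
      entry_weight x (hd ks) * harmonic_term s (tl ks))"
    unfolding mhs_star_def
    by (rule sum.cong) (auto simp: length_Suc_conv harmonic_term_Cons)
  also have "\<dots> = (\<Sum>k=1..n. \<Sum>ks | length ks = length s \<and> set ks \<subseteq> {1..k} \<and> sorted_wrt (\<ge>) ks.
      entry_weight x k * harmonic_term s ks)"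
    by (rule sum_lists_Cons) (fastforce simp: subset_iff)
  finally show ?thesis by (simp add: mhs_star_def sum_distrib_left)
qed

text \<open>Signs multiply and absolute values add, so merging two entries amounts to setting their
  summation variables equal.\<close>

lemma entry_weight_oplus:
  assumes "x \<noteq> 0" "y \<noteq> 0"
  shows "entry_weight (oplus x y) k = entry_weight x k * entry_weight y k"
proof -
  have "sgn (oplus x y) = sgn x * sgn y"
    using assms by (cases x "0::int" rule: linorder_cases; cases y "0::int" rule: linorder_cases)
      (auto simp: oplus_def)
  moreover have "nat \<bar>oplus x y\<bar> = nat \<bar>x\<bar> + nat \<bar>y\<bar>"
    using oplus_nonzero_abs(1)[OF assms] by (simp add: nat_add_distrib)
  ultimately show ?thesis
    by (simp add: entry_weight_def power_add power_mult_distrib)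
qed

section \<open>Sums over all merges of an index\<close>

text \<open>
  \<open>merge_tail t k * entry_weight x k\<close> is the sum over all chains
  \<open>k = k\<^sub>1 \<ge> k\<^sub>2 \<ge> \<dots> \<ge> 1\<close> of the terms of the index \<open>x # t\<close>, each chain counted with
  weight 2 to the number of its distinct values. Grouping the chains by their pattern of equalities
  turns this into the sum over \<open>index_merges\<close>.
\<close>

primrec merge_tail :: "int list \<Rightarrow> nat \<Rightarrow> real" where
  "merge_tail [] k = 2"
| "merge_tail (y # t) k = entry_weight y k * merge_tail t k +
     2 * (\<Sum>j=1..<k. entry_weight y j * merge_tail t j)"

definition merge_term :: "int list \<Rightarrow> nat \<Rightarrow> real" where
  "merge_term t k = entry_weight (hd t) k * merge_tail (tl t) k"

lemma merge_term_Cons: "merge_term (x # t) k = entry_weight x k * merge_tail t k"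
  by (simp add: merge_term_def)

text \<open>Induction on the first separator. Merging there gives the chains whose first two
  variables agree, by \<open>entry_weight_oplus\<close>; keeping the comma makes the second variable
  strictly smaller and adds a component, hence the factor 2 in \<open>merge_tail\<close>.\<close>

lemma merge_term_eq_sum:
  assumes "0 \<notin> set (x # t)"
  shows "merge_term (x # t) k = (\<Sum>p\<in>index_merges (x # t).
    2 ^ length p * (entry_weight (hd p) k * mhs (k - 1) (tl p)))"
  using assms
proof (induction t arbitrary: x k)
  case Nil
  then show ?case by (simp add: merge_term_def)
next
  case (Cons y t)
  have nz: "x \<noteq> 0" "y \<noteq> 0" "0 \<notin> set t"
    using Cons.prems by auto
  note o = oplus_nonzero_abs[OF nz(1,2)]
  let ?g = "\<lambda>k p. 2 ^ length p * (entry_weight (hd p) k * mhs (k - 1) (tl p))"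
  have fin: "finite (index_merges (y # t))" "finite (index_merges (oplus x y # t))"
    using finite_card_index_merges[of y t] finite_card_index_merges[of "oplus x y" t] nz o by auto
  \<comment> \<open>Every head on the right has absolute value at least
    \<open>\<bar>x\<bar> + \<bar>y\<bar>\<close>, so it differs from \<open>x\<close>.\<close>
  have disj: "(#) x ` index_merges (y # t) \<inter> index_merges (oplus x y # t) = {}"
    using index_merges_hd[of _ "oplus x y" t] nz o by fastforce
  have "?g k (x # p) = 2 * entry_weight x k * (\<Sum>j=1..<k. ?g j p)"
    if "p \<in> index_merges (y # t)" for p
  proof -
    from that index_merges_hd[of p y t] nz have "p \<noteq> []" by auto
    then have "mhs (k - 1) p = (\<Sum>j=1..k - 1. entry_weight (hd p) j * mhs (j - 1) (tl p))"
      using mhs_Cons[of "k - 1" "hd p" "tl p"] by simp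
    moreover have "{1..k - 1} = {1..<k}" by auto
    ultimately show ?thesis by (simp add: sum_distrib_left mult_ac)
  qed
  then have "(\<Sum>p\<in>(#) x ` index_merges (y # t). ?g k p) =
      (\<Sum>p\<in>index_merges (y # t). 2 * entry_weight x k * (\<Sum>j=1..<k. ?g j p))"
    by (subst sum.reindex) (auto intro!: sum.cong simp del: One_nat_def)
  also have "\<dots> = 2 * entry_weight x k * (\<Sum>j=1..<k. \<Sum>p\<in>index_merges (y # t). ?g j p)"
    by (subst sum.swap) (simp add: sum_distrib_left)
  also have "\<dots> = 2 * entry_weight x k * (\<Sum>j=1..<k. merge_term (y # t) j)"
    using Cons.IH[of y] nz by simp
  finally have 1: "(\<Sum>p\<in>(#) x ` index_merges (y # t). ?g k p) =
      2 * entry_weight x k * (\<Sum>j=1..<k. merge_term (y # t) j)" .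
  have 2: "(\<Sum>p\<in>index_merges (oplus x y # t). ?g k p) = merge_term (oplus x y # t) k"
    using Cons.IH[of "oplus x y" k] nz o by simp
  have "(\<Sum>p\<in>index_merges (x # y # t). ?g k p) =
      (\<Sum>p\<in>(#) x ` index_merges (y # t). ?g k p) + (\<Sum>p\<in>index_merges (oplus x y # t). ?g k p)"
    unfolding index_merges.simps by (rule sum.union_disjoint) (use fin disj in auto)
  then show ?case
    unfolding 1 2 by (simp add: merge_term_Cons entry_weight_oplus nz algebra_simps)
qed

section \<open>Sums weighted by quotients of binomial coefficients\<close>

text \<open>
  This is \<open>(n choose k) / (n + k choose k)\<close>; in the product form it vanishes for \<open>k > n\<close>
  and the recurrence in \<open>k\<close> needs no side condition.
\<close>

definition binom_ratio :: "nat \<Rightarrow> nat \<Rightarrow> real" where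
  "binom_ratio n k = (\<Prod>i=1..k. (real n + 1 - real i) / (real n + real i))"

lemma binom_ratio_Suc:
  "(real n + real k + 1) * binom_ratio n (Suc k) = (real n - real k) * binom_ratio n k"
proof -
  have "real n + real k + 1 \<noteq> 0" by linarith
  then show ?thesis by (simp add: binom_ratio_def field_simps)
qed

lemma binom_ratio_eq_0: "n < k \<Longrightarrow> binom_ratio n k = 0"
  unfolding binom_ratio_def by (rule prod_zero) (auto intro!: bexI[of _ "Suc n"])

lemma binom_ratio_bounds: "0 \<le> binom_ratio n k \<and> binom_ratio n k \<le> 1"
proof (cases "n < k")
  case True
  then show ?thesis by (simp add: binom_ratio_eq_0)
next
  case False
  then show ?thesis
    unfolding binom_ratio_def by (intro conjI prod_nonneg prod_le_1) (auto simp: divide_simps)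
qed

lemma binom_ratio_tendsto: "(\<lambda>n. binom_ratio n k) \<longlonglongrightarrow> 1"
proof -
  have "(\<lambda>n. binom_ratio n k) \<longlonglongrightarrow> (\<Prod>i=1..k. 1)"
    unfolding binom_ratio_def by (rule tendsto_prod) real_asymp
  then show ?thesis by simp
qed

text \<open>Both weights obey \<open>binom_ratio_Suc\<close>. Multiplying by the positive factor
  \<open>n + k\<close> makes both recurrences applicable in the induction on \<open>k\<close>, and
  the factor is cancelled at the end.\<close>

lemma binom_ratio_pred:
  assumes "n > 0"
  shows "(real n)\<^sup>2 * binom_ratio (n - 1) k = ((real n)\<^sup>2 - (real k)\<^sup>2) * binom_ratio n k"
proof (induction k)
  case 0
  then show ?case by (simp add: binom_ratio_def)
next
  case (Suc k)
  have n: "real (n - 1) = real n - 1" using assms by simp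
  have 1: "(real n + real k) * binom_ratio (n - 1) (Suc k) = (real n - 1 - real k) * binom_ratio (n - 1) k"
    using binom_ratio_Suc[of "n - 1" k] n by (simp add: algebra_simps)
  note 2 = binom_ratio_Suc[of n k]
  have "(real n + real k) * ((real n)\<^sup>2 * binom_ratio (n - 1) (Suc k)) =
      (real n - 1 - real k) * ((real n)\<^sup>2 * binom_ratio (n - 1) k)"
    using arg_cong[OF 1, of "\<lambda>z. (real n)\<^sup>2 * z"] by (simp add: algebra_simps)
  also have "\<dots> = (real n + real k) * (real n - 1 - real k) * ((real n - real k) * binom_ratio n k)"
    unfolding Suc.IH by (simp add: power2_eq_square algebra_simps)
  also have "\<dots> = (real n + real k) * (((real n)\<^sup>2 - (real (Suc k))\<^sup>2) * binom_ratio n (Suc k))"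
    unfolding 2[symmetric] by (simp add: power2_eq_square algebra_simps)
  finally show ?case using assms by simp
qed

text \<open>Telescoping: for T(j) = (n - j) w(j) with w = \<open>binom_ratio n\<close>, the
  recurrence gives T(j) - T(j+1) = 2 (j+1) w(j+1), and T(n) = 0.\<close>

lemma sum_tail_binom_ratio:
  assumes "j \<le> n"
  shows "2 * (\<Sum>k=Suc j..n. real k * binom_ratio n k) = (real n - real j) * binom_ratio n j"
  using assms
proof (induction j rule: inc_induct)
  case base
  then show ?case by simp
next
  case (step j)
  have "(\<Sum>k=Suc j..n. real k * binom_ratio n k) =
      real (Suc j) * binom_ratio n (Suc j) + (\<Sum>k=Suc (Suc j)..n. real k * binom_ratio n k)"
    using step.hyps by (subst sum.atLeast_Suc_atMost) auto
  then show ?case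
    using step.IH binom_ratio_Suc[of n j] by (simp add: algebra_simps)
qed

text \<open>The same telescoping with signs: the coefficients n+j+1 and n-j-1 are now added instead
  of subtracted, and their sum 2n does not depend on j.\<close>

lemma alternating_sum_tail_binom_ratio:
  assumes "j \<le> n"
  shows "2 * real n * (\<Sum>k=Suc j..n. (- 1) ^ k * binom_ratio n k) =
    - ((- 1) ^ j * (real n - real j) * binom_ratio n j)"
  using assms
proof (induction j rule: inc_induct)
  case base
  then show ?case by simp
next
  case (step j)
  have "(\<Sum>k=Suc j..n. (- 1) ^ k * binom_ratio n k) =
      (- 1) ^ Suc j * binom_ratio n (Suc j) + (\<Sum>k=Suc (Suc j)..n. (- 1) ^ k * binom_ratio n k)"
    using step.hyps by (subst sum.atLeast_Suc_atMost) auto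
  then have "2 * real n * (\<Sum>k=Suc j..n. (- 1) ^ k * binom_ratio n k) =
      2 * real n * ((- 1) ^ Suc j * binom_ratio n (Suc j)) +
      - ((- 1) ^ Suc j * (real n - real (Suc j)) * binom_ratio n (Suc j))"
    by (simp only: distrib_left step.IH)
  also have "\<dots> = - ((- 1) ^ j * ((real n + real j + 1) * binom_ratio n (Suc j)))"
    by (simp add: algebra_simps)
  finally have "2 * real n * (\<Sum>k=Suc j..n. (- 1) ^ k * binom_ratio n k) =
      - ((- 1) ^ j * ((real n + real j + 1) * binom_ratio n (Suc j)))" .
  then show ?case unfolding binom_ratio_Suc by simp
qed

section \<open>Effect of a new leading entry on weighted sums\<close>

definition binom_sum :: "nat \<Rightarrow> (nat \<Rightarrow> real) \<Rightarrow> real" where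
  "binom_sum n f = (\<Sum>k=1..n. binom_ratio n k * f k)"

lemma binom_sum_diff:
  assumes "n > 0"
  shows "binom_sum n f - binom_sum (n - 1) f =
    (\<Sum>k=1..n. (real k)\<^sup>2 * binom_ratio n k * f k) / (real n)\<^sup>2"
proof -
  \<comment> \<open>The weight \<open>binom_ratio (n - 1) n\<close> is 0, so the sum may be extended
    to \<open>n\<close>.\<close>
  have "binom_sum (n - 1) f = (\<Sum>k=1..n. binom_ratio (n - 1) k * f k)"
    unfolding binom_sum_def
    by (rule sum.mono_neutral_left) (auto simp: binom_ratio_eq_0)
  then have "binom_sum n f - binom_sum (n - 1) f =
      (\<Sum>k=1..n. (binom_ratio n k - binom_ratio (n - 1) k) * f k)"
    by (simp add: binom_sum_def sum_subtractf algebra_simps)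
  also have "\<dots> = (\<Sum>k=1..n. ((real k)\<^sup>2 * binom_ratio n k * f k) / (real n)\<^sup>2)"
  proof (rule sum.cong)
    fix k
    have "binom_ratio n k - binom_ratio (n - 1) k = (real k)\<^sup>2 * binom_ratio n k / (real n)\<^sup>2"
      using binom_ratio_pred[OF assms, of k] assms by (simp add: field_simps)
    then show "(binom_ratio n k - binom_ratio (n - 1) k) * f k =
        ((real k)\<^sup>2 * binom_ratio n k * f k) / (real n)\<^sup>2" by simp
  qed simp
  finally show ?thesis by (simp add: sum_divide_distrib)
qed

text \<open>Both sides vanish at \<open>n = 0\<close>, so matching increments suffices. A general
  \<open>u\<close>, constrained only for \<open>n > 0\<close>, admits the empty index: its star sum
  is 1 even at \<open>n = 0\<close>, where every \<open>binom_sum\<close> is 0.\<close>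

lemma mhs_star_Cons_eqI:
  assumes s: "\<And>n. n > 0 \<Longrightarrow> mhs_star n s = u n"
    and diff: "\<And>n. n > 0 \<Longrightarrow>
      (\<Sum>k=1..n. (real k)\<^sup>2 * binom_ratio n k * g k) = (real n)\<^sup>2 * entry_weight x n * u n"
  shows "mhs_star n (x # s) = binom_sum n g"
proof (induction n)
  case 0
  then show ?case by (simp add: mhs_star_Cons binom_sum_def)
next
  case (Suc n)
  have "binom_sum (Suc n) g - binom_sum n g = entry_weight x (Suc n) * u (Suc n)"
    using binom_sum_diff[of "Suc n" g] diff[of "Suc n"] by simp
  then show ?case using Suc s[of "Suc n"] by (simp add: mhs_star_Cons)
qed

lemma entry_weight_pos: "m > 0 \<Longrightarrow> entry_weight (int m) k = 1 / real k ^ m"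
  by (simp add: entry_weight_def)

lemma entry_weight_neg: "m > 0 \<Longrightarrow> entry_weight (- int m) k = (- 1) ^ k / real k ^ m"
  by (simp add: entry_weight_def)

lemma entry_weight_one: "entry_weight 1 k = 1 / real k"
  using entry_weight_pos[of 1 k] by simp

lemma mhs_star_Cons_two:
  assumes "\<And>n. mhs_star n s = binom_sum n f"
  shows "mhs_star n (2 # s) = binom_sum n (\<lambda>k. f k / (real k)\<^sup>2)"
  by (rule mhs_star_Cons_eqI[OF assms])
    (use entry_weight_pos[of 2] in \<open>auto simp: binom_sum_def intro!: sum.cong\<close>)

lemma mhs_star_replicate_two:
  assumes "\<And>n. mhs_star n s = binom_sum n f"
  shows "mhs_star n (replicate m 2 @ s) = binom_sum n (\<lambda>k. f k / real k ^ (2 * m))"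
proof (induction m arbitrary: n)
  case (Suc m)
  show ?case
    using mhs_star_Cons_two[OF Suc.IH, of n] by (simp add: power2_eq_square mult_ac)
qed (use assms in simp)

text \<open>Modelled on the recursion of \<open>merge_tail\<close>: for nonempty \<open>t\<close> it
  sends \<open>merge_term t\<close> to \<open>merge_term (1 # t)\<close>.\<close>

definition prepend_one :: "(nat \<Rightarrow> real) \<Rightarrow> nat \<Rightarrow> real" where
  "prepend_one f k = (f k + 2 * (\<Sum>j=1..<k. f j)) / real k"

lemma sum_times_partial_sum:
  fixes u f :: "nat \<Rightarrow> real"
  shows "(\<Sum>k=1..n. u k * (\<Sum>j=1..<k. f j)) = (\<Sum>j=1..n. f j * (\<Sum>k=Suc j..n. u k))"
proof -
  have "(\<Sum>k=1..n. u k * (\<Sum>j=1..<k. f j)) = (\<Sum>k=1..n. \<Sum>j | j \<in> {1..n} \<and> j < k. u k * f j)"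
    by (auto simp: sum_distrib_left intro!: sum.cong)
  also have "\<dots> = (\<Sum>j=1..n. \<Sum>k | k \<in> {1..n} \<and> j < k. u k * f j)"
    by (rule sum.swap_restrict) auto
  also have "\<dots> = (\<Sum>j=1..n. f j * (\<Sum>k=Suc j..n. u k))"
    by (auto simp: sum_distrib_left intro!: sum.cong)
  finally show ?thesis .
qed

text \<open>Interchanging the sums moves \<open>prepend_one\<close> from \<open>f\<close> to the
  weights \<open>u\<close>, where it only produces tails. These have closed forms for both weights
  used below.\<close>

lemma sum_prepend_one:
  "(\<Sum>k=1..n. real k * u k * prepend_one f k) =
    (\<Sum>j=1..n. f j * (u j + 2 * (\<Sum>k=Suc j..n. u k)))"
proof -
  have "(\<Sum>k=1..n. real k * u k * prepend_one f k) =
      (\<Sum>k=1..n. u k * f k + 2 * (u k * (\<Sum>j=1..<k. f j)))"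
    by (rule sum.cong[OF refl]) (auto simp: prepend_one_def field_simps)
  also have "\<dots> = (\<Sum>k=1..n. u k * f k) + 2 * (\<Sum>k=1..n. u k * (\<Sum>j=1..<k. f j))"
    by (simp only: sum.distrib sum_distrib_left[of 2])
  also have "\<dots> = (\<Sum>j=1..n. u j * f j + 2 * (f j * (\<Sum>k=Suc j..n. u k)))"
    by (simp only: sum_times_partial_sum sum.distrib sum_distrib_left[of 2])
  finally show ?thesis by (simp add: algebra_simps)
qed

text \<open>With u(k) = k w(k), w = \<open>binom_ratio n\<close>, the tail formula turns u(j) plus
  twice its tail into j w(j) + (n - j) w(j) = n w(j).\<close>

lemma mhs_star_Cons_one:
  assumes "\<And>n. mhs_star n s = binom_sum n f"
  shows "mhs_star n (1 # s) = binom_sum n (prepend_one f)"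
proof (rule mhs_star_Cons_eqI[OF assms])
  fix n :: nat assume "n > 0"
  have "(\<Sum>k=1..n. (real k)\<^sup>2 * binom_ratio n k * prepend_one f k) =
      (\<Sum>k=1..n. real k * (real k * binom_ratio n k) * prepend_one f k)"
    by (simp add: power2_eq_square mult_ac)
  also have "\<dots> = (\<Sum>j=1..n. real n * (binom_ratio n j * f j))"
    unfolding sum_prepend_one
    by (rule sum.cong) (auto simp: sum_tail_binom_ratio algebra_simps)
  finally show "(\<Sum>k=1..n. (real k)\<^sup>2 * binom_ratio n k * prepend_one f k) =
      (real n)\<^sup>2 * entry_weight 1 n * binom_sum n f"
    using \<open>n > 0\<close>
    by (simp add: entry_weight_one binom_sum_def sum_distrib_left power2_eq_square)
qed

text \<open>The innermost entry 1 needs its own argument because the empty star sum is no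
  \<open>binom_sum\<close>; here the full sum, the tail from \<open>j = 0\<close>, is
  evaluated.\<close>

lemma mhs_star_one: "mhs_star n [1] = binom_sum n (\<lambda>k. 2 / real k)"
proof (rule mhs_star_Cons_eqI[where u = "\<lambda>_. 1"])
  fix n :: nat assume "n > 0"
  have "(\<Sum>k=1..n. (real k)\<^sup>2 * binom_ratio n k * (2 / real k)) =
      2 * (\<Sum>k=Suc 0..n. real k * binom_ratio n k)"
    unfolding sum_distrib_left by (rule sum.cong) (auto simp: power2_eq_square)
  also have "\<dots> = real n"
    unfolding sum_tail_binom_ratio[OF le0] by (simp add: binom_ratio_def)
  finally show "(\<Sum>k=1..n. (real k)\<^sup>2 * binom_ratio n k * (2 / real k)) =
      (real n)\<^sup>2 * entry_weight 1 n * 1"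
    using \<open>n > 0\<close> by (simp add: entry_weight_one power2_eq_square)
qed simp

text \<open>Conjugating by the sign \<open>(-1)\<^sup>k\<close> turns \<open>prepend_one\<close> into division by \<open>n\<close>.\<close>

lemma alternating_sum_prepend_one:
  assumes "n > 0"
  shows "(\<Sum>k=1..n. (- 1) ^ k * real k * binom_ratio n k * prepend_one g k) =
    (\<Sum>k=1..n. (- 1) ^ k * real k * binom_ratio n k * g k) / real n"
proof -
  have "(\<Sum>k=1..n. (- 1) ^ k * real k * binom_ratio n k * prepend_one g k) =
      (\<Sum>k=1..n. real k * ((- 1) ^ k * binom_ratio n k) * prepend_one g k)"
    by (simp add: mult_ac)
  also have "\<dots> = (\<Sum>j=1..n. (- 1) ^ j * real j * binom_ratio n j * g j / real n)"
    unfolding sum_prepend_one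
  proof (rule sum.cong)
    fix j assume "j \<in> {1..n}"
    then have "2 * (\<Sum>k=Suc j..n. (- 1) ^ k * binom_ratio n k) =
        - ((- 1) ^ j * (real n - real j) * binom_ratio n j) / real n"
      using alternating_sum_tail_binom_ratio[of j n] assms by (simp add: field_simps)
    then show "g j * ((- 1) ^ j * binom_ratio n j +
        2 * (\<Sum>k=Suc j..n. (- 1) ^ k * binom_ratio n k)) =
        (- 1) ^ j * real j * binom_ratio n j * g j / real n"
      using assms by (simp only:) (simp add: field_simps)
  qed simp
  finally show ?thesis by (simp only: sum_divide_distrib)
qed

lemma alternating_sum_funpow_prepend_one:
  assumes "n > 0"
  shows "(\<Sum>k=1..n. (- 1) ^ k * real k * binom_ratio n k * (prepend_one ^^ m) g k) =
    (\<Sum>k=1..n. (- 1) ^ k * real k * binom_ratio n k * g k) / real n ^ m"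
proof (induction m)
  case (Suc m)
  show ?case
    using alternating_sum_prepend_one[OF assms, of "(prepend_one ^^ m) g"] Suc by (simp add: mult_ac)
qed simp

text \<open>In the increment the outer sign makes the sum alternating, each of the
  \<open>c - 2\<close> copies of \<open>prepend_one\<close> then contributes a factor 1/n, and the
  inner sign cancels the outer one.\<close>

lemma mhs_star_Cons_ge_two:
  assumes s: "\<And>n. mhs_star n s = binom_sum n f" and c: "c \<ge> 2"
  shows "mhs_star n (int c # s) = binom_sum n
    (\<lambda>k. (- 1) ^ k / real k * (prepend_one ^^ (c - 2)) (\<lambda>k. (- 1) ^ k / real k * f k) k)"
    (is "_ = binom_sum n ?g")
proof (rule mhs_star_Cons_eqI[OF s])
  fix n :: nat assume n: "n > 0"
  let ?h = "\<lambda>k. (- 1) ^ k / real k * f k"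
  have "(\<Sum>k=1..n. (real k)\<^sup>2 * binom_ratio n k * ?g k) =
      (\<Sum>k=1..n. (- 1) ^ k * real k * binom_ratio n k * (prepend_one ^^ (c - 2)) ?h k)"
    by (rule sum.cong) (auto simp: power2_eq_square)
  also have "\<dots> = (\<Sum>k=1..n. (- 1) ^ k * real k * binom_ratio n k * ?h k) / real n ^ (c - 2)"
    by (rule alternating_sum_funpow_prepend_one[OF n])
  also have "(\<Sum>k=1..n. (- 1) ^ k * real k * binom_ratio n k * ?h k) = binom_sum n f"
    unfolding binom_sum_def by (rule sum.cong) (auto simp flip: power_add mult.assoc)
  also have "real n ^ c = real n ^ (c - 2) * (real n)\<^sup>2"
    using c by (simp only: power_add[symmetric] le_add_diff_inverse2)
  then have "binom_sum n f / real n ^ (c - 2) = (real n)\<^sup>2 * entry_weight (int c) n * binom_sum n f"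
    using n c by (simp add: entry_weight_pos)
  finally show "(\<Sum>k=1..n. (real k)\<^sup>2 * binom_ratio n k * ?g k) =
      (real n)\<^sup>2 * entry_weight (int c) n * binom_sum n f" .
qed

section \<open>The finite identities\<close>

lemma prepend_one_merge_term: "t \<noteq> [] \<Longrightarrow> prepend_one (merge_term t) = merge_term (1 # t)"
  by (cases t) (auto simp: prepend_one_def merge_term_def entry_weight_one)

lemma funpow_prepend_one_merge_term:
  "t \<noteq> [] \<Longrightarrow> (prepend_one ^^ m) (merge_term t) = merge_term (replicate m 1 @ t)"
  by (induction m) (simp_all add: prepend_one_merge_term)

definition star_block :: "nat \<Rightarrow> nat \<Rightarrow> nat \<Rightarrow> int list" where
  "star_block a b c = replicate b 2 @ [int c] @ replicate a 2 @ [1]"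

definition merge_block :: "nat \<Rightarrow> nat \<Rightarrow> nat \<Rightarrow> int list" where
  "merge_block a b c = [- int (2 * b + 2)] @ replicate (c - 3) 1 @ [- int (2 * a + 2)]"

text \<open>The 1 prepends a 1 on the merge side, and the twos raise it to \<open>2 * a + 1\<close>
  through division by \<open>k ^ (2 * a)\<close>. The disjunction treats the end of the index
  together with a position before further blocks.\<close>

lemma mhs_star_two_one:
  assumes "s = [] \<and> t = [] \<or> t \<noteq> [] \<and> (\<forall>n. mhs_star n s = binom_sum n (merge_term t))"
  shows "mhs_star n (replicate a 2 @ 1 # s) = binom_sum n (merge_term (int (2 * a + 1) # t))"
proof -
  have one: "mhs_star n (1 # s) = binom_sum n (merge_term (1 # t))" for n
    using assms
  proof
    assume "s = [] \<and> t = []"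
    moreover have "merge_term [1] = (\<lambda>k. 2 / real k)"
      by (simp add: merge_term_def entry_weight_one fun_eq_iff)
    ultimately show ?thesis by (simp add: mhs_star_one)
  next
    assume "t \<noteq> [] \<and> (\<forall>n. mhs_star n s = binom_sum n (merge_term t))"
    then show ?thesis using mhs_star_Cons_one[of s "merge_term t" n]
      by (simp add: prepend_one_merge_term)
  qed
  have "merge_term (1 # t) k / real k ^ (2 * a) = merge_term (int (2 * a + 1) # t) k" for k
    using entry_weight_pos[of "2 * a + 1" k]
    by (simp only: merge_term_Cons entry_weight_one) (simp add: power_add)
  then show ?thesis
    using mhs_star_replicate_two[OF one, of n a] by simp
qed

text \<open>In \<open>mhs_star_Cons_ge_two\<close> the inner factor (-1)^k / k turns the head 2a+1
  into a barred 2a+2, and \<open>prepend_one\<close> supplies \<open>c - 2\<close> ones. The outer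
  factor and the \<open>b\<close> twos turn the first of these into a barred 2b+2.\<close>

lemma mhs_star_block:
  assumes s: "\<And>n. mhs_star n (replicate a 2 @ 1 # s) = binom_sum n (merge_term (int (2 * a + 1) # t))"
    and c: "c \<ge> 3"
  shows "mhs_star n (star_block a b c @ s) = binom_sum n (merge_term (merge_block a b c @ t))"
proof -
  let ?t = "- int (2 * a + 2) # t"
  have "(- 1) ^ k / real k * merge_term (int (2 * a + 1) # t) k = merge_term ?t k" for k
    using entry_weight_pos[of "2 * a + 1" k] entry_weight_neg[of "2 * a + 2" k]
    by (simp only: merge_term_Cons) simp
  then have h: "(\<lambda>k. (- 1) ^ k / real k * merge_term (int (2 * a + 1) # t) k) = merge_term ?t" ..
  \<comment> \<open>As \<open>c - 2\<close> is positive, one 1 can be set apart to become the barred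
    head; \<open>c - 3\<close> remain.\<close>
  have ones: "(prepend_one ^^ (c - 2)) (merge_term ?t) = merge_term (1 # replicate (c - 3) 1 @ ?t)"
    using c by (simp add: funpow_prepend_one_merge_term Suc_diff_Suc numeral_3_eq_3 numeral_2_eq_2
        flip: append_Cons replicate_Suc)
  have "(- 1) ^ k / real k * merge_term (1 # replicate (c - 3) 1 @ ?t) k / real k ^ (2 * b) =
      merge_term (merge_block a b c @ t) k" for k
    using entry_weight_neg[of "2 * b + 2" k]
    by (simp only: merge_block_def merge_term_Cons entry_weight_one append.simps append_assoc)
      (simp add: power_add power2_eq_square)
  then show ?thesis
    using mhs_star_replicate_two[OF mhs_star_Cons_ge_two[OF s], of c n b] c
    unfolding h ones by (simp add: star_block_def)
qed

text \<open>The claims are proved together: the first for \<open>j # js\<close> uses the second for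
  \<open>js\<close>, and the second for \<open>j # js\<close> uses the first for
  \<open>j # js\<close>.\<close>

lemma mhs_star_blocks:
  assumes "\<And>j. j \<in> set js \<Longrightarrow> c j \<ge> 3"
  shows "js \<noteq> [] \<Longrightarrow>
      mhs_star n (concat (map (\<lambda>j. star_block (a j) (b j) (c j)) js)) =
      binom_sum n (merge_term (concat (map (\<lambda>j. merge_block (a j) (b j) (c j)) js)))"
    and "mhs_star n (replicate m 2 @ 1 # concat (map (\<lambda>j. star_block (a j) (b j) (c j)) js)) =
      binom_sum n (merge_term (int (2 * m + 1) #
        concat (map (\<lambda>j. merge_block (a j) (b j) (c j)) js)))"
  using assms
proof (induction js arbitrary: n m)
  case Nil
  {
    case 1 then show ?case by simp
  next
    case 2 then show ?case using mhs_star_two_one[of "[]" "[]"] by simp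
  }
next
  case (Cons j js)
  have *: "mhs_star n (concat (map (\<lambda>j. star_block (a j) (b j) (c j)) (j # js))) =
      binom_sum n (merge_term (concat (map (\<lambda>j. merge_block (a j) (b j) (c j)) (j # js))))"
    if "\<And>i. i \<in> set (j # js) \<Longrightarrow> c i \<ge> 3" for n
    using mhs_star_block[OF Cons.IH(2), where a = "a j" and b = "b j" and c = "c j"] that by simp
  {
    case 1 then show ?case using * by blast
  next
    case 2
    have "concat (map (\<lambda>j. merge_block (a j) (b j) (c j)) (j # js)) \<noteq> []"
      by (simp add: merge_block_def)
    then show ?case using mhs_star_two_one *[OF 2] by blast
  }
qed

section \<open>Passing to the limit\<close>

lemma abs_entry_weight_le:
  assumes "k > 0" "int m \<le> \<bar>x\<bar>"
  shows "\<bar>entry_weight x k\<bar> \<le> 1 / real k ^ m"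
proof -
  have "\<bar>entry_weight x k\<bar> \<le> 1 / real k ^ nat \<bar>x\<bar>"
    by (auto simp: entry_weight_def power_abs sgn_if power_0_left divide_simps)
  also have "\<dots> \<le> 1 / real k ^ m"
    using assms by (intro divide_left_mono power_increasing) auto
  finally show ?thesis .
qed

text \<open>A crude bound of logarithmic growth, which a leading entry of absolute value at least 2
  outweighs.\<close>

lemma abs_mhs_le:
  assumes "0 \<notin> set s"
  shows "\<bar>mhs n s\<bar> \<le> harm n ^ length s"
  using assms
proof (induction s arbitrary: n)
  case (Cons x s)
  have "\<bar>mhs n (x # s)\<bar> \<le> (\<Sum>k=1..n. \<bar>entry_weight x k\<bar> * \<bar>mhs (k - 1) s\<bar>)"
    unfolding mhs_Cons by (rule order_trans[OF sum_abs]) (simp add: abs_mult)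
  also have "\<dots> \<le> (\<Sum>k=1..n. inverse (real k) * harm n ^ length s)"
  proof (intro sum_mono mult_mono)
    fix k assume k: "k \<in> {1..n}"
    show "\<bar>entry_weight x k\<bar> \<le> inverse (real k)"
      using abs_entry_weight_le[of k 1 x] k Cons.prems by (auto simp: inverse_eq_divide)
    have "\<bar>mhs (k - 1) s\<bar> \<le> harm (k - 1) ^ length s" using Cons by simp
    also have "\<dots> \<le> harm n ^ length s"
      using k by (intro power_mono harm_mono harm_nonneg) auto
    finally show "\<bar>mhs (k - 1) s\<bar> \<le> harm n ^ length s" .
  qed auto
  also have "\<dots> = harm n ^ length (x # s)"
    by (simp add: harm_def sum_distrib_right)
  finally show ?case .
qed simp

text \<open>The difference \<open>harm n - ln n\<close> decreases from its value 1 at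
  \<open>n = 1\<close>.\<close>

lemma harm_le_ln: "n > 0 \<Longrightarrow> harm n \<le> 1 + ln (real n)"
  using decseqD[OF decseq_harm_diff_ln, of 0 "n - 1"] by (simp add: harm_expand)

lemma summable_mzv_terms:
  assumes "0 \<notin> set p" "2 \<le> \<bar>x\<bar>"
  shows "summable (\<lambda>k. \<bar>entry_weight x (Suc k) * mhs k p\<bar>)"
proof (rule summable_comparison_test')
  let ?l = "length p"
  show "summable (\<lambda>k. (1 + ln (real (Suc k))) ^ ?l / (real (Suc k))\<^sup>2)"
  proof (rule summable_comparison_test_bigo)
    \<comment> \<open>Any exponent strictly between -2 and -1 absorbs the power of the logarithm and
      stays summable.\<close>
    show "summable (\<lambda>k. norm (real k powr (- 3 / 2)))"
      by (simp add: summable_real_powr_iff)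
    show "(\<lambda>k. (1 + ln (real (Suc k))) ^ ?l / (real (Suc k))\<^sup>2) \<in> O(\<lambda>k. real k powr (- 3 / 2))"
      by real_asymp
  qed
  fix k :: nat
  have "\<bar>mhs k p\<bar> \<le> harm k ^ ?l" by (rule abs_mhs_le[OF assms(1)])
  also have "\<dots> \<le> harm (Suc k) ^ ?l"
    by (intro power_mono harm_mono harm_nonneg) auto
  also have "\<dots> \<le> (1 + ln (real (Suc k))) ^ ?l"
    by (intro power_mono harm_le_ln harm_nonneg) auto
  finally show "norm \<bar>entry_weight x (Suc k) * mhs k p\<bar> \<le>
      (1 + ln (real (Suc k))) ^ ?l / (real (Suc k))\<^sup>2"
    using mult_mono[OF abs_entry_weight_le[of "Suc k" 2 x]] assms(2) by (fastforce simp: abs_mult)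
qed

lemma mzv_sums:
  assumes "0 \<notin> set p" "2 \<le> \<bar>x\<bar>"
  shows "(\<lambda>k. entry_weight x (Suc k) * mhs k p) sums mzv (x # p)"
proof -
  let ?f = "\<lambda>k. entry_weight x (Suc k) * mhs k p"
  have "mhs n (x # p) = (\<Sum>k<n. ?f k)" for n
    unfolding mhs_Cons by (rule sum.reindex_bij_witness[where i = Suc and j = "\<lambda>k. k - 1"]) auto
  moreover have "?f sums suminf ?f"
    by (rule summable_sums[OF summable_rabs_cancel[OF summable_mzv_terms[OF assms]]])
  ultimately show ?thesis
    by (simp add: mzv_def sums_def limI)
qed

lemma index_merges_nonzero: "p \<in> index_merges s \<Longrightarrow> 0 \<notin> set s \<Longrightarrow> 0 \<notin> set p"
proof (induction s arbitrary: p rule: index_merges.induct)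
  case (3 x y xs)
  then show ?case using oplus_nonzero_abs(2)[of x y] by fastforce
qed auto

text \<open>Merging never lowers the absolute value of the head, so each of the finitely many series
  belonging to \<open>index_merges\<close> converges absolutely.\<close>

lemma merge_term_sums:
  assumes "0 \<notin> set t" "2 \<le> \<bar>x\<bar>"
  shows "(\<lambda>k. merge_term (x # t) (Suc k)) sums
      (\<Sum>p\<in>index_merges (x # t). 2 ^ length p * mzv p)"
    and "summable (\<lambda>k. \<bar>merge_term (x # t) (Suc k)\<bar>)"
proof -
  let ?I = "index_merges (x # t)"
  have nz: "0 \<notin> set (x # t)" using assms by auto
  have I: "p = hd p # tl p" "0 \<notin> set (tl p)" "2 \<le> \<bar>hd p\<bar>" if "p \<in> ?I" for p
    using index_merges_hd[OF that nz] index_merges_nonzero[OF that nz] assms(2)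
    by (cases p; auto)+
  have eq: "merge_term (x # t) (Suc k) =
      (\<Sum>p\<in>?I. 2 ^ length p * (entry_weight (hd p) (Suc k) * mhs k (tl p)))" for k
    using merge_term_eq_sum[OF nz, of "Suc k"] by simp
  show "(\<lambda>k. merge_term (x # t) (Suc k)) sums (\<Sum>p\<in>?I. 2 ^ length p * mzv p)"
    unfolding eq
  proof (intro sums_sum sums_mult)
    fix p assume "p \<in> ?I"
    from I[OF this] show "(\<lambda>k. entry_weight (hd p) (Suc k) * mhs k (tl p)) sums mzv p"
      using mzv_sums[of "tl p" "hd p"] by simp
  qed
  show "summable (\<lambda>k. \<bar>merge_term (x # t) (Suc k)\<bar>)"
  proof (rule summable_comparison_test')
    show "summable (\<lambda>k. \<Sum>p\<in>?I. 2 ^ length p * \<bar>entry_weight (hd p) (Suc k) * mhs k (tl p)\<bar>)"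
      by (intro summable_sum summable_mult summable_mzv_terms I)
    show "norm \<bar>merge_term (x # t) (Suc k)\<bar> \<le>
        (\<Sum>p\<in>?I. 2 ^ length p * \<bar>entry_weight (hd p) (Suc k) * mhs k (tl p)\<bar>)" for k
      unfolding eq by (simp, rule order_trans[OF sum_abs]) (simp add: abs_mult)
  qed
qed

lemma binom_sum_tendsto:
  assumes "summable (\<lambda>k. \<bar>f (Suc k)\<bar>)"
  shows "(\<lambda>n. binom_sum n f) \<longlonglongrightarrow> (\<Sum>k. f (Suc k))"
proof -
  \<comment> \<open>Tannery's theorem applies with dominating series
    \<open>\<bar>f (Suc k)\<bar>\<close>, as the weights lie between 0 and 1 and tend to 1.\<close>
  have "(\<lambda>n. \<Sum>k. binom_ratio n (Suc k) * f (Suc k)) \<longlonglongrightarrow> (\<Sum>k. f (Suc k))"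
  proof (rule conjunct2[OF conjunct2[OF tannerys_theorem[OF _ _ assms]]])
    show "(\<lambda>n. binom_ratio n (Suc k) * f (Suc k)) \<longlonglongrightarrow> f (Suc k)" for k
      using tendsto_mult[OF binom_ratio_tendsto tendsto_const] by fastforce
    show "\<forall>\<^sub>F (k, n) in sequentially \<times>\<^sub>F sequentially.
        norm (binom_ratio n (Suc k) * f (Suc k)) \<le> \<bar>f (Suc k)\<bar>"
      using binom_ratio_bounds by (intro always_eventually) (auto simp: abs_mult mult_left_le_one_le)
  qed simp
  moreover have "(\<Sum>k. binom_ratio n (Suc k) * f (Suc k)) = binom_sum n f" for n
  proof -
    \<comment> \<open>The weights vanish for \<open>k \<ge> n\<close>, so the series is a finite
      sum.\<close>
    have "(\<Sum>k. binom_ratio n (Suc k) * f (Suc k)) = (\<Sum>k<n. binom_ratio n (Suc k) * f (Suc k))"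
      by (rule suminf_finite) (auto simp: binom_ratio_eq_0)
    also have "\<dots> = binom_sum n f"
      unfolding binom_sum_def
      by (rule sum.reindex_bij_witness[where i = "\<lambda>k. k - 1" and j = Suc]) auto
    finally show ?thesis .
  qed
  ultimately show ?thesis by simp
qed

lemma mzv_star_eq_merge_sum:
  assumes "\<And>n. mhs_star n s = binom_sum n (merge_term t)"
    and "t \<noteq> []" "0 \<notin> set t" "2 \<le> \<bar>hd t\<bar>"
  shows "mzv_star s = (\<Sum>p\<in>index_merges t. 2 ^ length p * mzv p)"
proof -
  obtain x u where t: "t = x # u" using assms(2) by (cases t) auto
  have u: "0 \<notin> set u" "2 \<le> \<bar>x\<bar>" using assms(3,4) t by auto
  show ?thesis
    using binom_sum_tendsto[OF merge_term_sums(2)[OF u]] sums_unique[OF merge_term_sums(1)[OF u]]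
    by (simp add: mzv_star_def assms(1) t limI)
qed

theorem theorem5p2:
  fixes a b c :: "nat \<Rightarrow> nat"
  assumes c: "\<And>j. j \<ge> 1 \<Longrightarrow> c j \<ge> 3"
  shows "(\<forall>r\<ge>1. mzv_star (star_index a b c r) =
            (\<Sum>p\<in>index_merges (merge_index a b c r). 2 ^ length p * mzv p)) \<and>
         (\<forall>r\<ge>0. a 0 \<ge> 1 \<longrightarrow>
            mzv_star (replicate (a 0) 2 @ [1] @ star_index a b c r) =
            (\<Sum>p\<in>index_merges (int (2 * a 0 + 1) # merge_index a b c r). 2 ^ length p * mzv p))"
proof (intro conjI allI impI)
  have star: "star_index a b c r = concat (map (\<lambda>j. star_block (a j) (b j) (c j)) [1..<r + 1])" for r
    by (simp add: star_index_def star_block_def)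
  have merge: "merge_index a b c r = concat (map (\<lambda>j. merge_block (a j) (b j) (c j)) [1..<r + 1])" for r
    by (simp add: merge_index_def merge_block_def)
  have cj: "c j \<ge> 3" if "j \<in> set [1..<r + 1]" for j r
    using c that by (simp only: set_upt atLeastLessThan_iff)
  have nz: "0 \<notin> set (merge_index a b c r)" for r
    by (auto simp: merge_index_def)
  fix r :: nat
  {
    assume r: "r \<ge> 1"
    \<comment> \<open>Exposes the head of the merge index, minus 2 b_1 + 2, whose absolute value is
      at least 2.\<close>
    then have "[1..<r + 1] = 1 # [2..<r + 1]"
      by (subst upt_conv_Cons) (auto simp: numeral_2_eq_2)
    then have "merge_index a b c r \<noteq> []" "2 \<le> \<bar>hd (merge_index a b c r)\<bar>" "[1..<r + 1] \<noteq> []"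
      by (simp_all add: merge_index_def)
    then show "mzv_star (star_index a b c r) =
        (\<Sum>p\<in>index_merges (merge_index a b c r). 2 ^ length p * mzv p)"
    proof (intro mzv_star_eq_merge_sum nz)
      show "mhs_star n (star_index a b c r) = binom_sum n (merge_term (merge_index a b c r))" for n
        unfolding star merge using mhs_star_blocks(1)[of "[1..<r + 1]" c n a b] cj \<open>[1..<r + 1] \<noteq> []\<close> by blast
    qed
  next
    \<comment> \<open>Makes the head 2 a_0 + 1 at least 3, which secures convergence.\<close>
    assume "a 0 \<ge> 1"
    moreover have "mhs_star n (replicate (a 0) 2 @ [1] @ star_index a b c r) =
        binom_sum n (merge_term (int (2 * a 0 + 1) # merge_index a b c r))" for n
      using mhs_star_blocks(2)[of "[1..<r + 1]" c n "a 0" a b] cj by (simp add: star merge)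
    ultimately show "mzv_star (replicate (a 0) 2 @ [1] @ star_index a b c r) =
        (\<Sum>p\<in>index_merges (int (2 * a 0 + 1) # merge_index a b c r). 2 ^ length p * mzv p)"
      using nz[of r] by (intro mzv_star_eq_merge_sum) auto
  }
qed

end
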